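(* Let $\Gamma$ be a Horn context. Then for every atom $r$ there exists a finitary term $N_r\in\overline{\lambda}^{gfp}_{\Sigma}$ with no free occurrences of fixpoint variables such that $[\![N_r]\!]=\mathcal{S}(\Gamma\Rightarrow r)$.
   Context: Formulas are built from atoms by implication $\supset$ (associating to the right). Horn formulas are $H::=p\mid p\supset H$ ($p$ an atom), i.e. formulas $q_1\supset\cdots\supset q_k\supset p$ with all $q_i$ atoms; a Horn context is a finite list of declarations $x:H$ with distinct variables and Horn formulas $H$. Böhm forests and elimination alternatives are the possibly infinite expressions generated coinductively by $N::=_{co}\lambda x^A.N\mid E_1+\cdots+E_n$, $E::=_{co}x\langle N_1,\dots,N_k\rangle$ ($n,k\ge0$); equality of Böhm forests is coinductive (bisimilarity) with sums of alternatives treated as sets (i.e. $+$ is associative, commutative, idempotent, with the empty sum $\mathbb{O}$ as neutral element). The solution space is defined corecursively by $\mathcal{S}(\Gamma\Rightarrow A\supset B)=\lambda x^A.\mathcal{S}(\Gamma,x:A\Rightarrow B)$ ($x$ fresh) and $\mathcal{S}(\Gamma\Rightarrow p)=\sum_{(y:B_1\supset\cdots\supset B_k\supset p)\in\Gamma}y\langle\mathcal{S}(\Gamma\Rightarrow B_1),\dots,\mathcal{S}(\Gamma\Rightarrow B_k)\rangle$ for $p$ an atom. The finitary calculus $\overline{\lambda}^{gfp}_{\Sigma}$ has (inductively defined) terms $N::=\lambda x^A.N\mid \mathrm{gfp}\,X.(E_1+\cdots+E_n)\mid X$ and elimination alternatives $E::=x\langle N_1,\dots,N_k\rangle$, where $X$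 ranges over a countably infinite set of fixpoint variables, bound by $\mathrm{gfp}$. An environment $\xi$ maps fixpoint variables to Böhm forests; the interpretation is defined by recursion: $[\![X]\!]_\xi=\xi(X)$; $[\![\lambda x^A.N]\!]_\xi=\lambda x^A.[\![N]\!]_\xi$; $[\![x\langle N_1,\dots,N_k\rangle]\!]_\xi=x\langle[\![N_1]\!]_\xi,\dots,[\![N_k]\!]_\xi\rangle$; $[\![\mathrm{gfp}\,X.\sum_iE_i]\!]_\xi$ is the unique Böhm forest $N$ satisfying $N=\sum_i[\![E_i]\!]_{\xi[X\mapsto N]}$. For a term without free fixpoint variables the interpretation does not depend on $\xi$ and is written $[\![N]\!]$. *)

theory Defs
  imports Main "HOL-Library.FSet"
begin

section \<open>Formulas and Horn contexts\<close>

datatype 'a fm =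
    is_Atom: Atom (atom_of: 'a)
  | Imp (antecedent: "'a fm") (consequent: "'a fm")  (infixr "\<^bold>\<supset>" 65)

primrec args :: "'a fm \<Rightarrow> 'a fm list" where
  "args (Atom p) = []"
| "args (A \<^bold>\<supset> B) = A # args B"

primrec target :: "'a fm \<Rightarrow> 'a" where
  "target (Atom p) = p"
| "target (A \<^bold>\<supset> B) = target B"

lemma fm_decompose: "A = foldr Imp (args A) (Atom (target A))"
  by (induction A) auto

type_synonym var = nat
type_synonym 'a ctx = "(var \<times> 'a fm) list"

inductive horn :: "'a fm \<Rightarrow> bool" where
  "horn (Atom p)"
| "horn H \<Longrightarrow> horn (Atom p \<^bold>\<supset> H)"

definition horn_context :: "'a ctx \<Rightarrow> bool" where
  "horn_context \<Gamma> \<longleftrightarrow> distinct (map fst \<Gamma>) \<and> (\<forall>(x, H) \<in> set \<Gamma>. horn H)"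


section \<open>Boehm forests\<close>

text \<open>
  Boehm forests are taken modulo renaming of bound variables, by a locally nameless
  representation: a head variable is a named free variable or a de Bruijn index.
  The alternatives of a sum form a finite set, and equality of a codatatype is bisimilarity,
  so HOL equality on \<open>bf\<close> is bisimilarity with \<open>+\<close> associative, commutative and idempotent,
  and \<open>BSum {||}\<close> is the empty sum.
\<close>

datatype head = Free var | Bound nat

codatatype 'a bf = BLam "'a fm" "'a bf" | BSum "'a balt fset"
  and 'a balt = BApp head "'a bf list"

primrec close_head :: "nat \<Rightarrow> var \<Rightarrow> head \<Rightarrow> head" where
  "close_head k x (Free y) = (if y = x then Bound k else Free y)"
| "close_head k x (Bound i) = Bound (if i < k then i else Suc i)"

primcorec close :: "nat \<Rightarrow> var \<Rightarrow> 'a bf \<Rightarrow> 'a bf"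
  and close_alt :: "nat \<Rightarrow> var \<Rightarrow> 'a balt \<Rightarrow> 'a balt" where
  "close k x N = (case N of
      BLam A M \<Rightarrow> BLam A (close (Suc k) x M)
    | BSum Es \<Rightarrow> BSum (fimage (close_alt k x) Es))"
| "close_alt k x E = (case E of BApp h Ns \<Rightarrow> BApp (close_head k x h) (map (close k x) Ns))"

text \<open>The forest \<open>\<lambda>x\<^sup>A. N\<close>, binding every free occurrence of \<open>x\<close> in \<open>N\<close>.\<close>

definition blam :: "var \<Rightarrow> 'a fm \<Rightarrow> 'a bf \<Rightarrow> 'a bf" where
  "blam x A N = BLam A (close 0 x N)"


section \<open>Solution spaces\<close>

primrec shift_head :: "head \<Rightarrow> head" where
  "shift_head (Free y) = Free y"
| "shift_head (Bound i) = Bound (Suc i)"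

text \<open>
  Under a binder, the new hypothesis is declared for index \<open>0\<close>, so no fresh name has to be
  chosen. The equations in terms of named contexts and fresh variables are the lemmas
  \<open>solspace_Imp\<close> and \<open>solspace_Atom\<close> below.
\<close>

primcorec solve :: "(head \<times> 'a fm) list \<Rightarrow> 'a fm \<Rightarrow> 'a bf"
  and solve_alt :: "(head \<times> 'a fm) list \<Rightarrow> head \<times> 'a fm \<Rightarrow> 'a balt" where
  "solve G C = (case C of
      A \<^bold>\<supset> B \<Rightarrow> BLam A (solve (map (map_prod shift_head id) G @ [(Bound 0, A)]) B)
    | Atom p \<Rightarrow> BSum (fimage (solve_alt G) (fset_of_list (filter (\<lambda>d. target (snd d) = p) G))))"
| "solve_alt G d = BApp (fst d) (map (solve G) (args (snd d)))"

definition solspace :: "'a ctx \<Rightarrow> 'a fm \<Rightarrow> 'a bf" ("\<S>'(_ \<Rightarrow> _')") where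
  "\<S>(\<Gamma> \<Rightarrow> A) = solve (map (map_prod Free id) \<Gamma>) A"

lemma close_simps:
  "close k x (BLam A M) = BLam A (close (Suc k) x M)"
  "close k x (BSum Es) = BSum (fimage (close_alt k x) Es)"
  "close_alt k x (BApp h Ns) = BApp (close_head k x h) (map (close k x) Ns)"
  by (subst close.code close_alt.code, simp)+

lemma solve_simps:
  "solve G (A \<^bold>\<supset> B) = BLam A (solve (map (map_prod shift_head id) G @ [(Bound 0, A)]) B)"
  "solve G (Atom p) = BSum (fimage (solve_alt G) (fset_of_list (filter (\<lambda>d. target (snd d) = p) G)))"
  "solve_alt G d = BApp (fst d) (map (solve G) (args (snd d)))"
  by (subst solve.code solve_alt.code, simp)+

lemma close_head_shift_head:
  "close_head (Suc k) x (shift_head h) = shift_head (close_head k x h)"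
  by (cases h) auto

lemma close_solve:
  fixes G :: "(head \<times> 'a fm) list"
  shows "close k x (solve G A) = solve (map (map_prod (close_head k x) id) G) A"
proof -
  let ?c = "\<lambda>k x. map_prod (close_head k x) id :: head \<times> 'a fm \<Rightarrow> head \<times> 'a fm"
  define R where "R = (\<lambda>N M. \<exists>k x G A.
    N = close k x (solve G A) \<and> M = solve (map (?c k x) G) A)"
  define S where "S = (\<lambda>E F. \<exists>k x G d.
    E = close_alt k x (solve_alt G d) \<and> F = solve_alt (map (?c k x) G) (?c k x d))"
  have R_intro: "R (close k x (solve G A)) (solve (map (?c k x) G) A)" for k x G A
    unfolding R_def by (rule exI[of _ k], rule exI[of _ x], rule exI[of _ G], rule exI[of _ A]) simp
  have S_intro: "S (close_alt k x (solve_alt G d)) (solve_alt (map (?c k x) G) (?c k x d))" for k x G d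
    unfolding S_def by (rule exI[of _ k], rule exI[of _ x], rule exI[of _ G], rule exI[of _ d]) simp
  have R: "is_BLam N = is_BLam M \<and>
      (is_BLam N \<longrightarrow> is_BLam M \<longrightarrow> un_BLam1 N = un_BLam1 M \<and> R (un_BLam2 N) (un_BLam2 M)) \<and>
      (\<not> is_BLam N \<longrightarrow> \<not> is_BLam M \<longrightarrow> rel_fset S (un_BSum N) (un_BSum M))" if "R N M" for N M
  proof -
    from that obtain k x G A where N: "N = close k x (solve G A)" and M: "M = solve (map (?c k x) G) A"
      unfolding R_def by blast
    show ?thesis
    proof (cases A)
      case (Atom p)
      have *: "filter (\<lambda>d. target (snd d) = p) (map (?c k x) G)
          = map (?c k x) (filter (\<lambda>d. target (snd d) = p) G)"
        by (simp add: filter_map comp_def)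
      show ?thesis
        unfolding N M Atom solve_simps(2) close_simps * fset_of_list_map
        by (simp add: fset.rel_map S_intro fset.rel_refl_strong)
    next
      case (Imp B C)
      have "map (map_prod shift_head id) (map (?c k x) G) @ [(Bound 0, B)]
          = map (?c (Suc k) x) (map (map_prod shift_head id) G @ [(Bound 0, B)])"
        by (auto simp: close_head_shift_head)
      then show ?thesis
        unfolding N M Imp solve_simps close_simps
        using R_intro by (simp del: map_map map_append)
    qed
  qed
  have S: "un_BApp1 E = un_BApp1 F \<and> list_all2 R (un_BApp2 E) (un_BApp2 F)" if "S E F" for E F
  proof -
    from that obtain k x G d where E: "E = close_alt k x (solve_alt G d)"
      and F: "F = solve_alt (map (?c k x) G) (?c k x d)"
      unfolding S_def by blast
    show ?thesis
      unfolding E F solve_simps close_simps by (simp add: list_all2_conv_all_nth R_intro)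
  qed
  show ?thesis
    using bf_balt.coinduct[of R S, OF R S] R_intro by blast
qed

lemma solspace_Imp:
  assumes "x \<notin> fst ` set \<Gamma>"
  shows "\<S>(\<Gamma> \<Rightarrow> A \<^bold>\<supset> B) = blam x A (\<S>(\<Gamma> @ [(x, A)] \<Rightarrow> B))"
proof -
  have "map (map_prod shift_head id \<circ> map_prod Free id) \<Gamma>
      = map (map_prod (close_head 0 x) id \<circ> map_prod Free id) \<Gamma>"
    using assms by (force simp: image_iff)
  then show ?thesis
    by (simp only: solspace_def blam_def solve_simps close_solve map_append map_map) simp
qed

lemma solspace_Atom:
  "\<S>(\<Gamma> \<Rightarrow> Atom p) = BSum (fset_of_list
     (map (\<lambda>(y, H). BApp (Free y) (map (\<lambda>B. \<S>(\<Gamma> \<Rightarrow> B)) (args H)))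
       (filter (\<lambda>(y, H). target H = p) \<Gamma>)))"
proof -
  let ?G = "map (map_prod Free id) \<Gamma>"
  have "solve_alt ?G (map_prod Free id d)
      = (case d of (y, H) \<Rightarrow> BApp (Free y) (map (\<lambda>B. \<S>(\<Gamma> \<Rightarrow> B)) (args H)))" for d
    unfolding solspace_def solve_simps by (simp split: prod.split)
  moreover have "filter (\<lambda>d. target (snd d) = p) ?G
      = map (map_prod Free id) (filter (\<lambda>(y, H). target H = p) \<Gamma>)"
    by (simp add: filter_map comp_def case_prod_unfold)
  ultimately show ?thesis
    by (simp only: solspace_def[of _ "Atom p"] solve_simps fset_of_list_map[symmetric] map_map comp_def)
qed


section \<open>Finitary terms\<close>

datatype 'a tm = Lam var "'a fm" "'a tm" | Gfp nat "'a alt list" | FixVar nat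
  and 'a alt = App var "'a tm list"

primrec fpv :: "'a tm \<Rightarrow> nat set" and fpv_alt :: "'a alt \<Rightarrow> nat set" where
  "fpv (Lam x A N) = fpv N"
| "fpv (Gfp X Es) = \<Union>(set (map fpv_alt Es)) - {X}"
| "fpv (FixVar X) = {X}"
| "fpv_alt (App x Ns) = \<Union>(set (map fpv Ns))"

text \<open>
  The abstraction \<open>blam\<close> may bind variables that are free in the values of the environment.
\<close>

primrec interp :: "'a tm \<Rightarrow> (nat \<Rightarrow> 'a bf) \<Rightarrow> 'a bf" ("\<lbrakk>_\<rbrakk>")
  and interp_alt :: "'a alt \<Rightarrow> (nat \<Rightarrow> 'a bf) \<Rightarrow> 'a balt" where
  "\<lbrakk>Lam x A N\<rbrakk> = (\<lambda>\<xi>. blam x A (\<lbrakk>N\<rbrakk> \<xi>))"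
| "\<lbrakk>Gfp X Es\<rbrakk> = (\<lambda>\<xi>. THE N. N = BSum (fset_of_list (map (\<lambda>E. interp_alt E (\<xi>(X := N))) Es)))"
| "\<lbrakk>FixVar X\<rbrakk> = (\<lambda>\<xi>. \<xi> X)"
| "interp_alt (App x Ns) = (\<lambda>\<xi>. BApp (Free x) (map (\<lambda>N. \<lbrakk>N\<rbrakk> \<xi>) Ns))"

end

theory Submission imports Defs begin

text \<open>
  In a Horn context every argument of a declaration is an atom, so the solution spaces of the
  atoms solve a system of guarded equations, one for each atom. Opening a fixpoint variable for an
  atom the first time it is met, and referring to that variable at every later occurrence, unfolds
  the system into a finitary term; this stops since there are finitely many atoms. With a set of
  atoms already opened, the interpretation of the term is the component of the solution of the
  system in which these atoms have been assigned the values of their variables. It is essential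
  that this system has exactly one solution for every assignment, because the interpretation of
  \<open>gfp\<close> is a definite description over arbitrary forests.
\<close>

text \<open>An argument enters only through its target, so that the unknowns of the system are
  indexed by atoms. For a Horn declaration this loses nothing, since its arguments are
  atoms.\<close>

definition decl_alt :: "('a \<Rightarrow> 'a bf) \<Rightarrow> var \<times> 'a fm \<Rightarrow> 'a balt" where
  "decl_alt f d = BApp (Free (fst d)) (map (\<lambda>B. f (target B)) (args (snd d)))"

definition decls :: "'a ctx \<Rightarrow> 'a \<Rightarrow> (var \<times> 'a fm) list" where
  "decls \<Gamma> p = filter (\<lambda>(y, H). target H = p) \<Gamma>"

definition solves :: "'a ctx \<Rightarrow> ('a \<rightharpoonup> 'a bf) \<Rightarrow> ('a \<Rightarrow> 'a bf) \<Rightarrow> bool" where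
  "solves \<Gamma> \<eta> f \<longleftrightarrow> (\<forall>p. f p =
     (case \<eta> p of Some M \<Rightarrow> M | None \<Rightarrow> BSum (fset_of_list (map (decl_alt f) (decls \<Gamma> p)))))"

lemma solvesD:
  assumes "solves \<Gamma> \<eta> f"
  shows "\<eta> p = Some M \<Longrightarrow> f p = M"
    and "\<eta> p = None \<Longrightarrow> f p = BSum (fset_of_list (map (decl_alt f) (decls \<Gamma> p)))"
  using assms unfolding solves_def by (metis option.simps(5), metis option.simps(4))

text \<open>The root is expanded even at an assigned atom, and \<open>\<eta>\<close> is consulted
  only at the arguments, so every corecursive call is guarded. The value at the root is corrected in
  \<open>solves_exists\<close>.\<close>

primcorec unfold :: "'a ctx \<Rightarrow> ('a \<rightharpoonup> 'a bf) \<Rightarrow> 'a \<Rightarrow> 'a bf"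
  and unfold_alt :: "'a ctx \<Rightarrow> ('a \<rightharpoonup> 'a bf) \<Rightarrow> var \<times> 'a fm \<Rightarrow> 'a balt" where
  "unfold \<Gamma> \<eta> p = BSum (fimage (unfold_alt \<Gamma> \<eta>) (fset_of_list (decls \<Gamma> p)))"
| "unfold_alt \<Gamma> \<eta> d = BApp (Free (fst d))
     (map (\<lambda>B. if \<eta> (target B) = None then unfold \<Gamma> \<eta> (target B) else the (\<eta> (target B))) (args (snd d)))"

lemma solves_exists: "\<exists>f. solves \<Gamma> \<eta> f"
proof -
  define f where "f p = (if \<eta> p = None then unfold \<Gamma> \<eta> p else the (\<eta> p))" for p
  have "unfold_alt \<Gamma> \<eta> = decl_alt f"
    by (rule ext) (subst unfold_alt.code, simp add: decl_alt_def f_def)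
  then have "solves \<Gamma> \<eta> f"
    unfolding solves_def f_def[of p for p]
    by (auto split: option.split) (subst unfold.code, simp)
  then show ?thesis by blast
qed

text \<open>Bisimulation: at an unassigned atom both sides expand along the same declarations. The
  relation includes equality because assigned forests are arbitrary; once one is reached, both sides
  agree.\<close>

lemma solves_unique:
  assumes f: "solves \<Gamma> \<eta> f" and g: "solves \<Gamma> \<eta> g"
  shows "f = g"
proof
  fix p
  define R where "R N M \<longleftrightarrow> N = M \<or> (\<exists>p. N = f p \<and> M = g p)" for N M
  define S where "S E F \<longleftrightarrow> E = F \<or> (\<exists>d. E = decl_alt f d \<and> F = decl_alt g d)" for E F
  have R: "is_BLam N = is_BLam M \<and>
      (is_BLam N \<longrightarrow> is_BLam M \<longrightarrow> un_BLam1 N = un_BLam1 M \<and> R (un_BLam2 N) (un_BLam2 M)) \<and>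
      (\<not> is_BLam N \<longrightarrow> \<not> is_BLam M \<longrightarrow> rel_fset S (un_BSum N) (un_BSum M))"
    if RNM: "R N M" for N M
  proof (cases "N = M")
    case True
    then show ?thesis by (auto simp: R_def S_def intro: fset.rel_refl)
  next
    case False
    with RNM obtain q where N: "N = f q" and M: "M = g q" and neq: "f q \<noteq> g q"
      unfolding R_def by blast
    with solvesD(1)[OF f] solvesD(1)[OF g] have "\<eta> q = None" by (cases "\<eta> q") auto
    then have "f q = BSum (decl_alt f |`| fset_of_list (decls \<Gamma> q))"
      "g q = BSum (decl_alt g |`| fset_of_list (decls \<Gamma> q))"
      using solvesD(2)[OF f] solvesD(2)[OF g] by simp_all
    then show ?thesis
      unfolding N M by (auto simp: fset.rel_map S_def intro!: fset.rel_refl_strong)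
  qed
  have S: "un_BApp1 E = un_BApp1 F \<and> list_all2 R (un_BApp2 E) (un_BApp2 F)" if "S E F" for E F
    using that unfolding S_def
    by (auto simp: decl_alt_def R_def list_all2_conv_all_nth)
  show "f p = g p"
    using bf_balt.coinduct[of R S, OF R S] unfolding R_def by blast
qed

text \<open>A Bekic-style principle. The left-hand side is the equation that \<open>gfp\<close>
  imposes on \<open>M\<close>: fix \<open>M\<close> as the value of \<open>p\<close>, solve for the
  other atoms, and ask for the equation of \<open>p\<close>. Such a \<open>g\<close> solves the
  system for \<open>\<eta>\<close> as well, so uniqueness applies; conversely \<open>f\<close>
  itself serves as \<open>g\<close>.\<close>

lemma solves_fixpoint:
  assumes f: "solves \<Gamma> \<eta> f" and p: "\<eta> p = None"
  shows "(\<exists>g. solves \<Gamma> (\<eta>(p \<mapsto> M)) g \<and> M = BSum (fset_of_list (map (decl_alt g) (decls \<Gamma> p))))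
    \<longleftrightarrow> M = f p"
proof
  assume "\<exists>g. solves \<Gamma> (\<eta>(p \<mapsto> M)) g \<and> M = BSum (fset_of_list (map (decl_alt g) (decls \<Gamma> p)))"
  then obtain g where g: "solves \<Gamma> (\<eta>(p \<mapsto> M)) g"
    and M: "M = BSum (fset_of_list (map (decl_alt g) (decls \<Gamma> p)))" by blast
  have gp: "g p = M" using solvesD(1)[OF g] by simp
  have "solves \<Gamma> \<eta> g"
    unfolding solves_def
  proof
    fix q
    show "g q = (case \<eta> q of Some M \<Rightarrow> M
        | None \<Rightarrow> BSum (fset_of_list (map (decl_alt g) (decls \<Gamma> q))))"
      using g[unfolded solves_def, rule_format, of q] gp M p by (cases "q = p") auto
  qed
  then show "M = f p" using solves_unique[OF f] gp by blast
next
  assume M: "M = f p"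
  have "solves \<Gamma> (\<eta>(p \<mapsto> M)) f"
    using f M by (auto simp: solves_def)
  then show "\<exists>g. solves \<Gamma> (\<eta>(p \<mapsto> M)) g \<and> M = BSum (fset_of_list (map (decl_alt g) (decls \<Gamma> p)))"
    using solvesD(2)[OF f p] M by blast
qed

definition assigned :: "('a \<Rightarrow> nat) \<Rightarrow> 'a set \<Rightarrow> (nat \<Rightarrow> 'a bf) \<Rightarrow> 'a \<rightharpoonup> 'a bf" where
  "assigned X V \<xi> = (\<lambda>p. if p \<in> V then Some (\<xi> (X p)) else None)"

text \<open>Injectivity ensures that rebinding \<open>X p\<close> leaves the values of the other
  opened atoms unchanged.\<close>

lemma assigned_insert:
  assumes "inj_on X (insert p V)" "p \<notin> V"
  shows "assigned X (insert p V) (\<xi>(X p := M)) = (assigned X V \<xi>)(p \<mapsto> M)"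
  using assms by (auto simp: assigned_def fun_eq_iff inj_on_def)

text \<open>Induction on the number of unopened atoms. \<open>N\<close> is chosen before
  \<open>\<xi>\<close>, because the body of a \<open>gfp\<close> is evaluated with every candidate
  value for its variable.\<close>

lemma finitary_solution:
  assumes A: "finite A" "\<And>y H B. (y, H) \<in> set \<Gamma> \<Longrightarrow> B \<in> set (args H) \<Longrightarrow> target B \<in> A"
    and X: "inj_on X A"
    and "V \<subseteq> A" "p \<in> A"
  shows "\<exists>N. fpv N \<subseteq> X ` V \<and> (\<forall>\<xi> f. solves \<Gamma> (assigned X V \<xi>) f \<longrightarrow> \<lbrakk>N\<rbrakk> \<xi> = f p)"
  using \<open>V \<subseteq> A\<close> \<open>p \<in> A\<close>
proof (induction "card (A - V)" arbitrary: V p rule: less_induct)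
  case less
  show ?case
  proof (cases "p \<in> V")
    case True
    then show ?thesis
      using solvesD(1) by (intro exI[of _ "FixVar (X p)"]) (fastforce simp: assigned_def)
  next
    case False
    then have "card (A - insert p V) < card (A - V)"
      using less.prems A(1) by (intro psubset_card_mono) auto
    then have "\<exists>N. fpv N \<subseteq> X ` insert p V \<and>
        (\<forall>\<xi> f. solves \<Gamma> (assigned X (insert p V) \<xi>) f \<longrightarrow> \<lbrakk>N\<rbrakk> \<xi> = f q)" if "q \<in> A" for q
      using less.hyps[of "insert p V" q] less.prems that by blast
    then obtain N where fpv: "\<And>q. q \<in> A \<Longrightarrow> fpv (N q) \<subseteq> X ` insert p V"
      and N: "\<And>q \<xi> f. q \<in> A \<Longrightarrow> solves \<Gamma> (assigned X (insert p V) \<xi>) f \<Longrightarrow> \<lbrakk>N q\<rbrakk> \<xi> = f q"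
      by metis
    define Es where
      "Es = map (\<lambda>d. App (fst d) (map (\<lambda>B. N (target B)) (args (snd d)))) (decls \<Gamma> p)"
    have args: "target B \<in> A" if "d \<in> set (decls \<Gamma> p)" "B \<in> set (args (snd d))" for d B
      using A(2)[of "fst d" "snd d"] that by (auto simp: decls_def)
    have "fpv_alt E \<subseteq> X ` insert p V" if "E \<in> set Es" for E
      using that fpv args unfolding Es_def by fastforce
    then have "fpv (Gfp (X p) Es) \<subseteq> X ` V" by auto
    moreover have "\<lbrakk>Gfp (X p) Es\<rbrakk> \<xi> = f p" if f: "solves \<Gamma> (assigned X V \<xi>) f" for \<xi> f
    proof -
      have inj: "inj_on X (insert p V)"
        using less.prems by (intro inj_on_subset[OF X]) auto
      have alts: "map (\<lambda>E. interp_alt E (\<xi>(X p := M))) Es = map (decl_alt g) (decls \<Gamma> p)"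
        if "solves \<Gamma> ((assigned X V \<xi>)(p \<mapsto> M)) g" for M g
        using N[of _ "\<xi>(X p := M)" g] that args
        unfolding assigned_insert[OF inj False] Es_def by (auto simp: decl_alt_def)
      have p: "assigned X V \<xi> p = None"
        using False by (simp add: assigned_def)
      \<comment> \<open>\<open>solves_exists\<close> supplies a \<open>g\<close> for each candidate
        \<open>M\<close>, which turns the equation of \<open>gfp\<close> into the one of
        \<open>solves_fixpoint\<close>. The definite description therefore denotes
        \<open>f p\<close>.\<close>
      have "M = BSum (fset_of_list (map (\<lambda>E. interp_alt E (\<xi>(X p := M))) Es)) \<longleftrightarrow> M = f p" for M
        using solves_fixpoint[OF f p, of M] alts[of M]
          solves_exists[of \<Gamma> "(assigned X V \<xi>)(p \<mapsto> M)"]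
        by metis
      then show ?thesis by simp
    qed
    ultimately show ?thesis by blast
  qed
qed

lemma horn_args: "horn H \<Longrightarrow> B \<in> set (args H) \<Longrightarrow> B = Atom (target B)"
  by (induction rule: horn.induct) auto

text \<open>The Horn hypothesis enters here: all arguments are atoms, so no binder arises and the
  context stays \<open>\<Gamma>\<close> throughout.\<close>

lemma solves_solspace:
  assumes "horn_context \<Gamma>"
  shows "solves \<Gamma> Map.empty (\<lambda>p. \<S>(\<Gamma> \<Rightarrow> Atom p))"
proof -
  have "Atom (target B) = B" if "(y, H) \<in> set \<Gamma>" "B \<in> set (args H)" for y H B
    using assms horn_args[of H B] that by (auto simp: horn_context_def)
  then have "map (decl_alt (\<lambda>p. \<S>(\<Gamma> \<Rightarrow> Atom p))) (decls \<Gamma> p)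
      = map (\<lambda>(y, H). BApp (Free y) (map (\<lambda>B. \<S>(\<Gamma> \<Rightarrow> B)) (args H)))
          (filter (\<lambda>(y, H). target H = p) \<Gamma>)" for p
    unfolding decls_def by (auto simp: decl_alt_def)
  then show ?thesis
    unfolding solves_def by (simp add: solspace_Atom)
qed

theorem theorem16:
  fixes \<Gamma> :: "'a ctx" and r :: 'a
  assumes "horn_context \<Gamma>"
  shows "\<exists>N :: 'a tm. fpv N = {} \<and> (\<forall>\<xi>. \<lbrakk>N\<rbrakk> \<xi> = \<S>(\<Gamma> \<Rightarrow> Atom r))"
proof -
  \<comment> \<open>The type of atoms may be infinite; \<open>A\<close> is a finite set that
    contains \<open>r\<close> and all arguments of declarations.\<close>
  define A where "A = insert r (\<Union>(y, H)\<in>set \<Gamma>. target ` set (args H))"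
  have "finite A" by (auto simp: A_def)
  obtain X :: "'a \<Rightarrow> nat" where "inj_on X A"
    using finite_imp_inj_to_nat_seg[OF \<open>finite A\<close>] by blast
  then obtain N :: "'a tm" where "fpv N \<subseteq> X ` {}"
    and N: "\<forall>\<xi> f. solves \<Gamma> (assigned X {} \<xi>) f \<longrightarrow> \<lbrakk>N\<rbrakk> \<xi> = f r"
    using finitary_solution[of A \<Gamma> X "{}" r] \<open>finite A\<close> \<open>inj_on X A\<close> by (fastforce simp: A_def)
  moreover have "assigned X {} \<xi> = Map.empty" for \<xi> :: "nat \<Rightarrow> 'a bf"
    by (simp add: assigned_def)
  ultimately show ?thesis
    using solves_solspace[OF assms] by auto
qed

end
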